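(* For every $n\ge 1$, the poset $(\mathcal{S}_{2n}, \leq_{\mathcal{S}})$ of Schröder paths of length $2n$ has exactly $2^n$ connected components.
   Context: A Schröder path is a non-empty lattice path in $\mathbb{Z}^2$ starting at $(0,0)$, ending on the diagonal $y=x$, staying weakly above the diagonal, with steps $N=(0,1)$, $E=(1,0)$, $D=(1,1)$, where the length counts each $N$ and each $E$ step as $1$ and each $D$ step as $2$. $\mathcal{S}_{2n}$ is the set of Schröder paths of length $2n$ (equivalently, those ending at $(n,n)$). Order: a valley of a path $P$ is a lattice point $v$ on $P$ preceded by an $E$ step and followed by an $N$ or $D$ step. Given a valley $v$ of $P$, let $w$ be the next lattice point on $P$ (end point of a step) after $v$ with the same horizontal distance to the diagonal as $v$ (the horizontal distance of $(a,b)$ is $b-a$). Exchanging the sub-path of $P$ between $v$ and $w$ with the $E$ step just before $v$ gives a Schröder path $Q$ of the same length; one says $Q$ covers $P$. The order $\leq_{\mathcal{S}}$ on $\mathcal{S}_{2n}$ is the reflexive transitive closure of this covering relation. Connected components of a poset are those of its Hasse diagram. *)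

theory Defs
  imports Main "HOL-Library.Product_Plus"
begin

datatype step = North | East | Diag

fun step_vec :: "step \<Rightarrow> int \<times> int" where
  "step_vec North = (0, 1)"
| "step_vec East = (1, 0)"
| "step_vec Diag = (1, 1)"

fun step_len :: "step \<Rightarrow> nat" where
  "step_len North = 1"
| "step_len East = 1"
| "step_len Diag = 2"

text \<open>
  A path starting at the origin is represented by its list of steps, and its lattice points by
  the number of steps leading to them (no step has a lattice point in its interior, and different
  numbers of steps lead to different points).
\<close>

definition path_point :: "step list \<Rightarrow> nat \<Rightarrow> int \<times> int" where
  "path_point P i = sum_list (map step_vec (take i P))"

definition path_length :: "step list \<Rightarrow> nat" where
  "path_length P = sum_list (map step_len P)"

fun hdist :: "int \<times> int \<Rightarrow> int" where
  "hdist (a, b) = b - a"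

definition schroeder_path :: "step list \<Rightarrow> bool" where
  "schroeder_path P \<longleftrightarrow>
     P \<noteq> [] \<and>
     fst (path_point P (length P)) = snd (path_point P (length P)) \<and>
     (\<forall>i \<le> length P. fst (path_point P i) \<le> snd (path_point P i))"

definition schroeder_paths :: "nat \<Rightarrow> step list set" where
  "schroeder_paths l = {P. schroeder_path P \<and> path_length P = l}"

definition valley :: "step list \<Rightarrow> nat \<Rightarrow> bool" where
  "valley P i \<longleftrightarrow>
     0 < i \<and> i < length P \<and> P ! (i - 1) = East \<and> (P ! i = North \<or> P ! i = Diag)"

definition next_same_hdist :: "step list \<Rightarrow> nat \<Rightarrow> nat \<Rightarrow> bool" where
  "next_same_hdist P i j \<longleftrightarrow>
     i < j \<and> j \<le> length P \<and> hdist (path_point P j) = hdist (path_point P i) \<and>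
     (\<forall>k. i < k \<and> k < j \<longrightarrow> hdist (path_point P k) \<noteq> hdist (path_point P i))"

definition exchange :: "step list \<Rightarrow> nat \<Rightarrow> nat \<Rightarrow> step list" where
  "exchange P i j = take (i - 1) P @ drop i (take j P) @ [East] @ drop j P"

text \<open>A pair \<open>(P, Q)\<close> in this relation means that \<open>Q\<close> covers \<open>P\<close>.\<close>

definition schroeder_cover :: "nat \<Rightarrow> step list rel" where
  "schroeder_cover l =
     {(P, Q). P \<in> schroeder_paths l \<and> Q \<in> schroeder_paths l \<and>
        (\<exists>i j. valley P i \<and> next_same_hdist P i j \<and> Q = exchange P i j)}"

text \<open>
  The intersection only removes the reflexive pairs that \<^const>\<open>rtrancl\<close> adds outside of
  \<open>schroeder_paths l\<close>.
\<close>

definition schroeder_le :: "nat \<Rightarrow> step list rel" where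
  "schroeder_le l = (schroeder_cover l)\<^sup>* \<inter> schroeder_paths l \<times> schroeder_paths l"

definition hasse_diagram :: "'a set \<Rightarrow> 'a rel \<Rightarrow> 'a rel" where
  "hasse_diagram A r =
     {(x, y). x \<in> A \<and> y \<in> A \<and> x \<noteq> y \<and> (x, y) \<in> r \<and>
        (\<forall>z \<in> A. (x, z) \<in> r \<and> (z, y) \<in> r \<longrightarrow> z = x \<or> z = y)}"

definition connected_components :: "'a set \<Rightarrow> 'a rel \<Rightarrow> 'a set set" where
  "connected_components A r =
     A // ((hasse_diagram A r \<union> (hasse_diagram A r)\<inverse>)\<^sup>* \<inter> A \<times> A)"

end

theory Submission
  imports Defs
begin

text \<open>
  A cover moves one \<^const>\<open>East\<close> step to the right, so it preserves the word of the remaining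
  \<^const>\<open>North\<close> and \<^const>\<open>Diag\<close> steps, which has length \<open>n\<close>. Conversely, a path without valleys
  has all its \<^const>\<open>East\<close> steps at the end and is therefore determined by this word; going up
  along covers from any path ends in such a path. Hence the components correspond to the words.
\<close>

section \<open>Heights, words and inversions of step lists\<close>

fun step_height :: "step \<Rightarrow> int" where
  "step_height North = 1"
| "step_height East = -1"
| "step_height Diag = 0"

definition height :: "step list \<Rightarrow> int" where
  "height P = sum_list (map step_height P)"

lemma height_simps [simp]:
  "height [] = 0"
  "height (s # P) = step_height s + height P"
  "height (P @ Q) = height P + height Q"
  "height (replicate k s) = int k * step_height s"
  by (simp_all add: height_def sum_list_replicate)

text \<open>The start height \<open>c\<close> is a parameter so that the pieces of a path can be
  treated separately: a cover raises one piece and leaves the others at their height.\<close>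

fun nonneg_from :: "int \<Rightarrow> step list \<Rightarrow> bool" where
  "nonneg_from c [] \<longleftrightarrow> 0 \<le> c"
| "nonneg_from c (s # P) \<longleftrightarrow> 0 \<le> c \<and> nonneg_from (c + step_height s) P"

definition word :: "step list \<Rightarrow> step list" where
  "word P = filter (\<lambda>s. s \<noteq> East) P"

lemma word_simps [simp]:
  "word [] = []"
  "word (s # P) = (if s = East then word P else s # word P)"
  "word (P @ Q) = word P @ word Q"
  "word (replicate k East) = []"
  by (simp_all add: word_def)

text \<open>The number of pairs formed by an \<^const>\<open>East\<close> step and a later step of another kind.\<close>

fun inversions :: "step list \<Rightarrow> nat" where
  "inversions [] = 0"
| "inversions (s # P) = (if s = East then length (word P) else 0) + inversions P"

text \<open>\<open>height w\<close> East steps are what brings \<open>w\<close> back to the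
  diagonal. For the word of a Schroeder path, the result is the top element of its
  component.\<close>

definition normal_path :: "step list \<Rightarrow> step list" where
  "normal_path w = w @ replicate (nat (height w)) East"

section \<open>Schroeder paths in terms of heights\<close>

lemma hdist_add: "hdist (p + q) = hdist p + hdist q"
  by (cases p; cases q) simp

lemma hdist_path_point: "hdist (path_point P i) = height (take i P)"
proof -
  have "hdist (sum_list (map step_vec L)) = height L" for L
  proof (induction L)
    case Nil
    then show ?case by (simp add: zero_prod_def)
  next
    case (Cons s L)
    then show ?case by (cases s) (simp_all add: hdist_add)
  qed
  then show ?thesis by (simp add: path_point_def)
qed

lemma hdist_eq: "hdist p = snd p - fst p"
  by (cases p) simp

lemma nonneg_from_start: "nonneg_from c P \<Longrightarrow> 0 \<le> c"
  by (cases P) simp_all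

lemma nonneg_from_end: "nonneg_from c P \<Longrightarrow> 0 \<le> c + height P"
  by (induction P arbitrary: c) force+

lemma nonneg_from_append:
  "nonneg_from c (P @ Q) \<longleftrightarrow> nonneg_from c P \<and> nonneg_from (c + height P) Q"
  by (induction P arbitrary: c) (auto simp: add.assoc dest: nonneg_from_start)

lemma nonneg_from_mono: "nonneg_from c P \<Longrightarrow> c \<le> d \<Longrightarrow> nonneg_from d P"
proof (induction P arbitrary: c d)
  case (Cons s P)
  have "nonneg_from (d + step_height s) P"
    using Cons.prems by (auto intro: Cons.IH[of "c + step_height s"])
  then show ?case using Cons.prems by simp
qed simp

lemma nonneg_from_iff_take:
  "nonneg_from c P \<longleftrightarrow> (\<forall>k \<le> length P. 0 \<le> c + height (take k P))"
proof (induction P arbitrary: c)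
  case (Cons s P)
  have "(\<forall>k \<le> length (s # P). 0 \<le> c + height (take k (s # P))) \<longleftrightarrow>
      0 \<le> c \<and> (\<forall>k \<le> length P. 0 \<le> c + height (take (Suc k) (s # P)))"
    (is "(\<forall>k \<le> _. ?P k) \<longleftrightarrow> _")
  proof -
    have "(\<forall>k \<le> Suc m. ?P k) \<longleftrightarrow> ?P 0 \<and> (\<forall>k \<le> m. ?P (Suc k))" for m
      by (metis Suc_le_mono le0 not0_implies_Suc)
    then show ?thesis by simp
  qed
  then show ?case by (simp add: Cons.IH add.assoc)
qed simp

lemma schroeder_path_iff:
  "schroeder_path P \<longleftrightarrow> P \<noteq> [] \<and> height P = 0 \<and> nonneg_from 0 P"
proof -
  have le: "fst (path_point P k) \<le> snd (path_point P k) \<longleftrightarrow> 0 \<le> height (take k P)" for k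
    unfolding hdist_path_point[symmetric] by (simp add: hdist_eq)
  have eq: "fst (path_point P k) = snd (path_point P k) \<longleftrightarrow> height (take k P) = 0" for k
    unfolding hdist_path_point[symmetric] by (auto simp: hdist_eq)
  show ?thesis by (simp add: schroeder_path_def le eq nonneg_from_iff_take)
qed

text \<open>Length plus height is 2 for North and Diag and 0 for East. For a path that ends on the
  diagonal, length \<open>2 * n\<close> thus means \<open>n\<close> steps other than East.\<close>

lemma path_length_eq: "int (path_length P) + height P = 2 * int (length (word P))"
proof (induction P)
  case (Cons s P)
  then show ?case by (cases s) (simp_all add: path_length_def)
qed (simp add: path_length_def)

lemma mem_schroeder_paths_iff:
  "P \<in> schroeder_paths (2 * n) \<longleftrightarrow>
    P \<noteq> [] \<and> height P = 0 \<and> nonneg_from 0 P \<and> length (word P) = n"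
  using path_length_eq[of P] by (auto simp: schroeder_paths_def schroeder_path_iff)

section \<open>Effect of a cover on words and inversions\<close>

text \<open>The product counts the pairs split between the lists: East steps of \<open>P\<close>
  times other steps of \<open>Q\<close>.\<close>

lemma inversions_append:
  "inversions (P @ Q) =
    inversions P + inversions Q + (length P - length (word P)) * length (word Q)"
proof (induction P)
  case (Cons s P)
  have "length (word P) \<le> length P" by (simp add: word_def)
  with Cons show ?case by (simp add: Suc_diff_le)
qed simp

text \<open>The exchanged sub-path is given as \<open>s # A\<close> because its first step, not
  being East, makes the number of inversions drop strictly.\<close>

lemma cover_decompose:
  assumes "valley P i" "next_same_hdist P i j"
  obtains X s A B where "P = X @ East # (s # A) @ B"
    "exchange P i j = X @ (s # A) @ East # B" "s \<noteq> East"
proof -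
  have i: "0 < i" "i < length P" "P ! (i - 1) = East" "P ! i \<noteq> East" and j: "i < j" "j \<le> length P"
    using assms by (auto simp: valley_def next_same_hdist_def)
  have "take j P = take i P @ drop i (take j P)"
    using append_take_drop_id[of i "take j P"] j by (simp add: min_def)
  moreover have "take i P = take (i - 1) P @ [East]"
    using i take_Suc_conv_app_nth[of "i - 1" P] by simp
  ultimately have "P = (take (i - 1) P @ [East]) @ drop i (take j P) @ drop j P"
    by (metis append_take_drop_id append.assoc)
  moreover have "drop i (take j P) = P ! i # drop (Suc i) (take j P)"
    using i j by (simp add: Cons_nth_drop_Suc[symmetric])
  ultimately show thesis
    using that[of "take (i - 1) P" "P ! i" "drop (Suc i) (take j P)" "drop j P"] i
    by (simp add: exchange_def)
qed

lemma cover_word: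
  assumes "(P, Q) \<in> schroeder_cover l"
  shows "word Q = word P"
  using assms by (auto simp: schroeder_cover_def elim!: cover_decompose)

text \<open>The moved East step loses its pairs with the other kinds of steps that it passes, among
  them the first one; all remaining pairs keep their order.\<close>

lemma cover_inversions:
  assumes "(P, Q) \<in> schroeder_cover l"
  shows "inversions Q < inversions P"
  using assms
  by (auto simp: schroeder_cover_def inversions_append add_mult_distrib elim!: cover_decompose)

section \<open>Every valley gives a cover\<close>

text \<open>A step lowers the height by at most one, so the height cannot jump over 0: at the first
  positive position where it is at most 0, it equals 0.\<close>

lemma first_return:
  assumes "s \<noteq> East" "height (s # Y) \<le> 0"
  obtains j where "0 < j" "j \<le> length (s # Y)" "height (take j (s # Y)) = 0"
    "\<And>k. 0 < k \<Longrightarrow> k < j \<Longrightarrow> height (take k (s # Y)) \<noteq> 0"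
proof -
  let ?h = "\<lambda>j. height (take j (s # Y))"
  define j where "j = (LEAST j. 0 < j \<and> ?h j \<le> 0)"
  have ex: "0 < length (s # Y) \<and> ?h (length (s # Y)) \<le> 0"
    using assms(2) by simp
  have j: "0 < j" "?h j \<le> 0"
    using LeastI[of "\<lambda>j. 0 < j \<and> ?h j \<le> 0", OF ex] by (simp_all add: j_def)
  have le: "j \<le> length (s # Y)"
    unfolding j_def by (rule Least_le) (rule ex)
  have before: "0 < ?h k" if "0 < k" "k < j" for k
    using not_less_Least[of k "\<lambda>j. 0 < j \<and> ?h j \<le> 0"] that by (force simp: j_def)
  obtain m where m: "j = Suc m" using j(1) by (cases j) auto
  have "0 \<le> ?h j"
  \<comment> \<open>For \<open>m = 0\<close> the fact \<open>before\<close> is silent, and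
    \<open>s \<noteq> East\<close> is used instead.\<close>
  proof (cases m)
    case 0
    then show ?thesis using m assms(1) by (cases s) simp_all
  next
    case (Suc m')
    have "?h j = ?h m + step_height ((s # Y) ! m)"
      using le m by (simp only: take_Suc_conv_app_nth Suc_le_lessD) simp
    moreover have "0 < ?h m" by (rule before) (simp_all add: m Suc)
    moreover have "-1 \<le> step_height t" for t by (cases t) simp_all
    ultimately show ?thesis by (smt (verit))
  qed
  with j(2) have "?h j = 0" by (rule order_antisym)
  show thesis
  proof (rule that)
    show "?h k \<noteq> 0" if "0 < k" "k < j" for k
      using before[OF that] by (rule less_imp_neq[symmetric])
  qed fact+
qed

text \<open>The valley has height at least 0 and the path ends at height 0, so the rest
  \<open>s # Y\<close> descends weakly and returns to the height of the valley.\<close>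

lemma cover_exists:
  assumes P: "P \<in> schroeder_paths (2 * n)" and dec: "P = X @ East # s # Y" and s: "s \<noteq> East"
  shows "\<exists>Q. (P, Q) \<in> schroeder_cover (2 * n)"
proof -
  have nn: "height P = 0" "nonneg_from 0 P" and len: "length (word P) = n"
    using P by (simp_all add: mem_schroeder_paths_iff)
  have "0 \<le> height (X @ [East])"
    using nn(2) nonneg_from_end[of 0 "X @ [East]"] nonneg_from_append[of 0 "X @ [East]" "s # Y"]
    by (simp add: dec)
  then have "height (s # Y) \<le> 0" using nn(1) by (simp add: dec)
  with s obtain k where k: "0 < k" "k \<le> length (s # Y)" "height (take k (s # Y)) = 0"
      "\<And>m. 0 < m \<Longrightarrow> m < k \<Longrightarrow> height (take m (s # Y)) \<noteq> 0"
    by (rule first_return) (rule that)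
  define A B where "A = take k (s # Y)" and "B = drop k (s # Y)"
  \<comment> \<open>The valley is the point after \<open>X\<close> and its East step;
    \<open>k\<close> counts steps from there.\<close>
  define i where "i = Suc (length X)"
  have AB: "s # Y = A @ B" unfolding A_def B_def by simp
  have P_AB: "P = X @ East # A @ B" by (simp only: dec AB)
  define Q where "Q = X @ A @ East # B"
  have take_P: "take (i + m) P = X @ East # take m (s # Y)" for m
    unfolding dec i_def by simp
  have drop_P: "drop (i + m) P = drop m (s # Y)" for m
    unfolding dec i_def by simp
  have "valley P i"
    using s by (cases s) (simp_all add: valley_def dec i_def nth_append)
  moreover have "next_same_hdist P i (i + k)"
    unfolding next_same_hdist_def hdist_path_point
  proof (intro conjI allI impI)
    show "i < i + k" using k(1) by simp
    show "i + k \<le> length P" using k(2) by (simp add: dec i_def)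
    show "height (take (i + k) P) = height (take i P)"
      using take_P[of k] take_P[of 0] k(3) by simp
    fix m assume "i < m \<and> m < i + k"
    then obtain m' where "m = i + m'" "0 < m'" "m' < k"
      by (metis add_less_cancel_left less_imp_add_positive)
    then show "height (take m P) \<noteq> height (take i P)"
      using take_P[of m'] take_P[of 0] k(4)[of m'] by simp
  qed
  moreover have "exchange P i (i + k) = Q"
  proof -
    have "take (i - 1) P = X" by (simp add: dec i_def)
    moreover have "drop i (take (i + k) P) = A"
      unfolding take_P A_def by (simp add: i_def)
    ultimately show ?thesis by (simp add: exchange_def Q_def drop_P B_def)
  qed
  moreover have "Q \<in> schroeder_paths (2 * n)"
  proof -
    have hA: "height A = 0" using k(3) by (simp add: A_def)
    \<comment> \<open>In \<open>Q\<close>, the piece \<open>A\<close> starts at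
      \<open>height X\<close> instead of \<open>height X - 1\<close>. As \<open>A\<close> has height
      0, \<open>B\<close> starts where it did before.\<close>
    have "nonneg_from 0 X" "nonneg_from (height X - 1) A" "nonneg_from (height X - 1) B"
      using nn(2) by (auto simp: P_AB nonneg_from_append hA)
    moreover have "0 \<le> height X" using \<open>nonneg_from 0 X\<close> nonneg_from_end by fastforce
    ultimately have "nonneg_from 0 Q"
      by (auto simp: Q_def nonneg_from_append hA intro: nonneg_from_mono)
    moreover have "height Q = 0" using nn(1) by (simp add: P_AB Q_def)
    moreover have "length (word Q) = n" using len by (simp add: P_AB Q_def)
    ultimately show ?thesis by (simp add: mem_schroeder_paths_iff Q_def)
  qed
  ultimately show ?thesis using P by (auto simp: schroeder_cover_def)
qed

section \<open>Normal forms and their words\<close>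

text \<open>The only new case in the induction is an East step put before a sorted tail: it forms a
  valley with the first letter of the word, or the tail is all East.\<close>

lemma valley_or_sorted:
  "(\<exists>X s Y. P = X @ East # s # Y \<and> s \<noteq> East) \<or> (\<exists>k. P = word P @ replicate k East)"
proof (induction P)
  case (Cons t P)
  then show ?case
  proof
    assume "\<exists>X s Y. P = X @ East # s # Y \<and> s \<noteq> East"
    then show ?thesis by (metis append_Cons)
  next
    assume "\<exists>k. P = word P @ replicate k East"
    then obtain k where k: "P = word P @ replicate k East" ..
    show ?thesis
    proof (cases "t = East")
      case False
      with k show ?thesis by auto
    next
      case True
      show ?thesis
      proof (cases "word P")
        case Nil
        with k True have "t # P = word (t # P) @ replicate (Suc k) East" by simp
        then show ?thesis by blast
      next
        case (Cons s w)
        moreover have "East \<notin> set (word P)" by (simp add: word_def)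
        ultimately have "s \<noteq> East" by auto
        moreover have "t # P = [] @ East # s # w @ replicate k East"
          using k True Cons by simp
        ultimately show ?thesis by blast
      qed
    qed
  qed
qed simp

text \<open>Inversions bound the climb along covers. Where it stops there is no valley, and height 0
  fixes the number of final East steps.\<close>

lemma normal_path_reachable:
  assumes "P \<in> schroeder_paths (2 * n)"
  shows "(P, normal_path (word P)) \<in> (schroeder_cover (2 * n))\<^sup>*"
  using assms
proof (induction "inversions P" arbitrary: P rule: less_induct)
  case less
  from valley_or_sorted[of P] show ?case
  proof (elim disjE exE conjE)
    fix X s Y assume "P = X @ East # s # Y" "s \<noteq> East"
    then obtain Q where Q: "(P, Q) \<in> schroeder_cover (2 * n)"
      using cover_exists less.prems by blast
    moreover have "Q \<in> schroeder_paths (2 * n)"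
      using Q by (simp add: schroeder_cover_def)
    ultimately show ?thesis
      using less.hyps[OF cover_inversions[OF Q]] cover_word[OF Q]
      by (simp add: converse_rtrancl_into_rtrancl)
  next
    fix k assume k: "P = word P @ replicate k East"
    have "height P = height (word P) - int k" by (subst k) simp
    then have "k = nat (height (word P))"
      using less.prems by (simp add: mem_schroeder_paths_iff)
    then have "normal_path (word P) = P" using k by (simp add: normal_path_def)
    then show ?thesis by simp
  qed
qed

lemma normal_path_word:
  assumes "set w \<subseteq> {North, Diag}"
  shows "word (normal_path w) = w"
  using assms by (auto simp: normal_path_def word_def intro!: filter_True)

lemma normal_path_in_schroeder_paths:
  assumes w: "set w \<subseteq> {North, Diag}" and "w \<noteq> []"
  shows "normal_path w \<in> schroeder_paths (2 * length w)"
proof -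
  have up: "nonneg_from c w \<and> 0 \<le> height w" if "0 \<le> c" for c
    using w that by (induction w arbitrary: c) force+
  have down: "nonneg_from (int k) (replicate k East)" for k
    by (induction k) simp_all
  have "nonneg_from 0 (normal_path w)"
    using up[of 0] down[of "nat (height w)"] by (simp add: normal_path_def nonneg_from_append)
  then show ?thesis
    using up[of 0] assms(2) normal_path_word[OF w]
    by (simp add: mem_schroeder_paths_iff) (simp add: normal_path_def)
qed

lemma word_image:
  assumes "n \<ge> 1"
  shows "word ` schroeder_paths (2 * n) = {w. set w \<subseteq> {North, Diag} \<and> length w = n}"
proof (intro equalityI subsetI)
  fix w assume "w \<in> word ` schroeder_paths (2 * n)"
  moreover have "t \<noteq> East \<Longrightarrow> t = North \<or> t = Diag" for t by (cases t) simp_all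
  ultimately show "w \<in> {w. set w \<subseteq> {North, Diag} \<and> length w = n}"
    by (auto simp: mem_schroeder_paths_iff) (auto simp: word_def)
next
  fix w assume w: "w \<in> {w. set w \<subseteq> {North, Diag} \<and> length w = n}"
  \<comment> \<open>Paths are non-empty by definition, so \<open>n \<ge> 1\<close> is needed to make
    \<open>w\<close> non-empty.\<close>
  then have "normal_path w \<in> schroeder_paths (2 * n)"
    using assms normal_path_in_schroeder_paths[of w] by (cases w) auto
  then show "w \<in> word ` schroeder_paths (2 * n)"
    using w normal_path_word[of w] by force
qed

section \<open>From covers to components of the Hasse diagram\<close>

lemma rtrancl_cover_word: "(P, Q) \<in> (schroeder_cover l)\<^sup>* \<Longrightarrow> word Q = word P"
  by (induction rule: rtrancl_induct) (simp_all add: cover_word)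

lemma rtrancl_cover_inversions:
  assumes "(P, Q) \<in> (schroeder_cover l)\<^sup>*" "P \<noteq> Q"
  shows "inversions Q < inversions P"
proof -
  have "(P, Q) \<in> (schroeder_cover l)\<^sup>+" using assms by (simp add: rtrancl_eq_or_trancl)
  then show ?thesis
    by (induction rule: trancl_induct) (auto dest: cover_inversions)
qed

text \<open>A related pair outside the diagram splits at some \<open>z\<close> into two pairs with
  smaller differences of \<open>m\<close>. This avoids showing that \<open>schroeder_cover\<close>
  is itself the Hasse diagram of its closure.\<close>

lemma subset_rtrancl_hasse_diagram:
  fixes m :: "'a \<Rightarrow> nat"
  assumes sub: "r \<subseteq> A \<times> A"
    and decr: "\<And>x y. (x, y) \<in> r \<Longrightarrow> x \<noteq> y \<Longrightarrow> m y < m x"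
    and xy: "(x, y) \<in> r"
  shows "(x, y) \<in> (hasse_diagram A r)\<^sup>*"
  using xy
proof (induction "m x - m y" arbitrary: x y rule: less_induct)
  case less
  show ?case
  proof (cases "x = y \<or> (x, y) \<in> hasse_diagram A r")
    case False
    then obtain z where z: "(x, z) \<in> r" "(z, y) \<in> r" "z \<noteq> x" "z \<noteq> y"
      using less.prems sub by (auto simp: hasse_diagram_def)
    have "m z < m x" "m y < m z" using decr z by blast+
    then have "m x - m z < m x - m y" "m z - m y < m x - m y" by auto
    then show ?thesis using less.hyps z(1,2) by (meson rtrancl_trans)
  qed auto
qed

text \<open>Edges of \<open>H\<close> preserve the word. Conversely, two paths with the same word
  both climb to the same normal path.\<close>

lemma component_relation:
  fixes n :: nat
  defines "A \<equiv> schroeder_paths (2 * n)"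
  defines "H \<equiv> hasse_diagram A (schroeder_le (2 * n))"
  shows "(H \<union> H\<inverse>)\<^sup>* \<inter> A \<times> A = {(P, Q). P \<in> A \<and> Q \<in> A \<and> word P = word Q}"
proof (intro equalityI subrelI)
  fix P Q assume PQ: "(P, Q) \<in> (H \<union> H\<inverse>)\<^sup>* \<inter> A \<times> A"
  have H: "word R = word S" if "(R, S) \<in> H" for R S
    using that rtrancl_cover_word[of R S "2 * n"]
    by (simp add: H_def hasse_diagram_def schroeder_le_def)
  have "word P = word Q" using IntD1[OF PQ]
    by (induction rule: rtrancl_induct) (auto dest: H)
  then show "(P, Q) \<in> {(P, Q). P \<in> A \<and> Q \<in> A \<and> word P = word Q}"
    using PQ by simp
next
  fix P Q assume "(P, Q) \<in> {(P, Q). P \<in> A \<and> Q \<in> A \<and> word P = word Q}"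
  then have PQ: "P \<in> A" "Q \<in> A" "word P = word Q" by simp_all
  have up: "(R, normal_path (word R)) \<in> H\<^sup>*" if "R \<in> A" for R
  proof -
    let ?C = "schroeder_cover (2 * n)"
    have reach: "(R, normal_path (word R)) \<in> ?C\<^sup>*"
      using that normal_path_reachable by (simp add: A_def)
    \<comment> \<open>The end of the climb is either \<open>R\<close> itself or the target of a last
      cover.\<close>
    then have "normal_path (word R) \<in> A"
      using that by (cases rule: rtrancl.cases) (auto simp: schroeder_cover_def A_def)
    with reach that have le: "(R, normal_path (word R)) \<in> schroeder_le (2 * n)"
      by (simp add: schroeder_le_def A_def)
    show ?thesis unfolding H_def
      by (rule subset_rtrancl_hasse_diagram[where m = inversions, OF _ _ le])
        (auto simp: schroeder_le_def A_def intro: rtrancl_cover_inversions)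
  qed
  have "(P, normal_path (word P)) \<in> (H \<union> H\<inverse>)\<^sup>*"
    using up[OF PQ(1)] rtrancl_mono[of H "H \<union> H\<inverse>"] by blast
  \<comment> \<open>The climb from \<open>Q\<close> is walked backwards.\<close>
  moreover have "(normal_path (word P), Q) \<in> (H \<union> H\<inverse>)\<^sup>*"
    using up[OF PQ(2)] PQ(3) rtrancl_mono[of "H\<inverse>" "H \<union> H\<inverse>"]
    by (auto simp: rtrancl_converse)
  ultimately have "(P, Q) \<in> (H \<union> H\<inverse>)\<^sup>*" by (rule rtrancl_trans)
  then show "(P, Q) \<in> (H \<union> H\<inverse>)\<^sup>* \<inter> A \<times> A" using PQ by simp
qed

section \<open>Counting the components\<close>

text \<open>The classes are the fibers of \<open>f\<close> over its values; these are non-empty, so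
  different values have different fibers.\<close>

lemma card_quotient_kernel:
  "card (A // {(x, y). x \<in> A \<and> y \<in> A \<and> f x = f y}) = card (f ` A)"
proof -
  let ?fiber = "\<lambda>w. {y \<in> A. f y = w}"
  let ?R = "{(x, y). x \<in> A \<and> y \<in> A \<and> f x = f y}"
  have "A // ?R = (\<lambda>x. ?R `` {x}) ` A" by (auto simp: quotient_def)
  also have "\<dots> = (\<lambda>x. ?fiber (f x)) ` A" by (rule image_cong) auto
  also have "\<dots> = ?fiber ` f ` A" by (simp add: image_image)
  finally have "A // ?R = ?fiber ` f ` A" .
  moreover have "inj_on ?fiber (f ` A)" by (rule inj_onI) blast
  ultimately show ?thesis by (simp add: card_image)
qed

theorem proposition5p1:
  fixes n :: nat
  assumes "n \<ge> 1"
  shows "card (connected_components (schroeder_paths (2 * n)) (schroeder_le (2 * n))) = 2 ^ n"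
proof -
  have "card (connected_components (schroeder_paths (2 * n)) (schroeder_le (2 * n))) =
      card (word ` schroeder_paths (2 * n))"
    by (simp only: connected_components_def component_relation card_quotient_kernel)
  also have "\<dots> = card {North, Diag} ^ n"
    unfolding word_image[OF assms] by (rule card_lists_length_eq) simp
  finally show ?thesis by (simp add: numeral_2_eq_2)
qed

end
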